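(* Let $F:A\times B\to Z$ be a single-valued mapping. Suppose that $F$ is partially Gâteaux differentiable with respect to each variable in $A\times B$. If $F$ is order-increasing (respectively, order-decreasing) in $A$ with respect to the first variable at some point $\bar y\in B$, then for any given $w\in A$, $$\partial_1F(w,\bar y)(v)\succcurlyeq_M\theta_Z\ (\text{respectively, }\preccurlyeq_M\theta_Z)\quad\text{for any } v\in C\setminus\{\theta_X\}.$$ In particular, if $F$ is partially Fréchet differentiable with respect to each variable in $A\times B$ and $F$ is order-increasing (respectively, order-decreasing) in $A$ with respect to the first variable at some point $\bar y\in B$, then for any given $w\in A$, $$\nabla_1F(w,\bar y)(v)\succcurlyeq_M\theta_Z\ (\text{respectively, }\preccurlyeq_M\theta_Z)\quad\text{for any } v\in C\setminus\{\theta_X\}.$$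
   Context: $(X,\|\cdot\|_X,\preccurlyeq_C)$, $(Y,\|\cdot\|_Y,\preccurlyeq_K)$, $(Z,\|\cdot\|_Z,\preccurlyeq_M)$ are partially ordered Banach spaces whose orders are generated by nonempty closed convex pointed cones $C\subseteq X$, $K\subseteq Y$, $M\subseteq Z$ (e.g. $x\preccurlyeq_Cv$ iff $v-x\in C$); null elements are $\theta_X,\theta_Y,\theta_Z$. $A\subseteq X$, $B\subseteq Y$ are nonempty convex open subsets. $F$ is order-increasing (order-decreasing) in $A$ with respect to the first variable at $\bar y\in B$ if for all $x,v\in A$, $x\preccurlyeq_Cv$ implies $F(x,\bar y)\preccurlyeq_MF(v,\bar y)$ (respectively $F(v,\bar y)\preccurlyeq_MF(x,\bar y)$). Partial Gâteaux differentiability with respect to the first (second) variable at $(\bar x,\bar y)$ means that $\partial_1F(\bar x,\bar y)(v)=\lim_{t\to0}\frac{F(\bar x+tv,\bar y)-F(\bar x,\bar y)}{t}$ exists for every $v\in X\setminus\{\theta_X\}$ ($\partial_2F(\bar x,\bar y)(u)=\lim_{t\to0}\frac{F(\bar x,\bar y+tu)-F(\bar x,\bar y)}{t}$ exists for every $u\in Y\setminus\{\theta_Y\}$), $t$ real. Partial Fréchet differentiability means that there is a continuous linear $\nabla_1F(\bar x,\bar y):X\to Z$ with $\lim_{u\to\theta_X}\frac{F(\bar x+u,\bar y)-F(\bar x,\bar y)-\nabla_1F(\bar x,\bar y)(u)}{\|u\|_X}=\theta_Z$ (a continuous linear $\nabla_2F(\bar x,\bar y):Y\to Z$ with $\lim_{w\to\theta_Y}\frac{F(\bar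 x,\bar y+w)-F(\bar x,\bar y)-\nabla_2F(\bar x,\bar y)(w)}{\|w\|_Y}=\theta_Z$). *)

theory Defs
  imports "HOL-Analysis.Analysis"
begin

definition ordering_cone :: "'a::real_normed_vector set \<Rightarrow> bool" where
  "ordering_cone C \<longleftrightarrow>
     C \<noteq> {} \<and> closed C \<and> convex C \<and> cone C \<and> C \<inter> uminus ` C = {0}"

definition cone_le :: "'a::real_normed_vector \<Rightarrow> 'a set \<Rightarrow> 'a \<Rightarrow> bool"
    (\<open>(\<open>notation=\<open>mixfix cone_le\<close>\<close>_ \<preceq>\<^bsub>_\<^esub> _)\<close> [51, 0, 51] 50) where
  "x \<preceq>\<^bsub>C\<^esub> v \<longleftrightarrow> v - x \<in> C"

lemma cone_le_refl: "ordering_cone C \<Longrightarrow> x \<preceq>\<^bsub>C\<^esub> x"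
  by (auto simp: ordering_cone_def cone_le_def)

lemma cone_le_antisym:
  assumes "ordering_cone C" "x \<preceq>\<^bsub>C\<^esub> y" "y \<preceq>\<^bsub>C\<^esub> x"
  shows "x = y"
proof -
  have "y - x \<in> C \<inter> uminus ` C"
    using assms(2,3) imageI[of "x - y" C uminus] by (simp add: cone_le_def)
  then have "y - x = 0"
    using assms(1) unfolding ordering_cone_def by blast
  then show ?thesis by simp
qed

lemma cone_le_trans:
  assumes "ordering_cone C" "x \<preceq>\<^bsub>C\<^esub> y" "y \<preceq>\<^bsub>C\<^esub> z"
  shows "x \<preceq>\<^bsub>C\<^esub> z"
proof -
  have "\<forall>a\<in>C. \<forall>b\<in>C. a + b \<in> C"
    using assms(1) convex_cone[of C] unfolding ordering_cone_def by simp
  then have "(y - x) + (z - y) \<in> C"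
    using assms(2,3) unfolding cone_le_def by blast
  then show ?thesis
    by (simp add: cone_le_def)
qed

text \<open>
  A mapping defined on \<open>A \<times> B\<close> is represented by a total function on pairs. The values outside
  \<open>A \<times> B\<close> are irrelevant: monotonicity is tested on \<open>A\<close> only, and the limits below are
  taken at points of the open set \<open>A \<times> B\<close>.
\<close>

definition order_increasing_1 ::
    "'x::real_normed_vector set \<Rightarrow> 'z::real_normed_vector set \<Rightarrow> 'x set \<Rightarrow> ('x \<times> 'y \<Rightarrow> 'z) \<Rightarrow> 'y \<Rightarrow> bool"
  where
  "order_increasing_1 C M A F y \<longleftrightarrow>
     (\<forall>x\<in>A. \<forall>v\<in>A. x \<preceq>\<^bsub>C\<^esub> v \<longrightarrow> F (x, y) \<preceq>\<^bsub>M\<^esub> F (v, y))"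

definition order_decreasing_1 ::
    "'x::real_normed_vector set \<Rightarrow> 'z::real_normed_vector set \<Rightarrow> 'x set \<Rightarrow> ('x \<times> 'y \<Rightarrow> 'z) \<Rightarrow> 'y \<Rightarrow> bool"
  where
  "order_decreasing_1 C M A F y \<longleftrightarrow>
     (\<forall>x\<in>A. \<forall>v\<in>A. x \<preceq>\<^bsub>C\<^esub> v \<longrightarrow> F (v, y) \<preceq>\<^bsub>M\<^esub> F (x, y))"

definition gateaux_differentiable_at ::
    "('a::real_normed_vector \<Rightarrow> 'b::real_normed_vector) \<Rightarrow> 'a \<Rightarrow> bool" where
  "gateaux_differentiable_at f x \<longleftrightarrow>
     (\<forall>v. v \<noteq> 0 \<longrightarrow> (\<exists>l. ((\<lambda>t::real. (f (x + t *\<^sub>R v) - f x) /\<^sub>R t) \<longlongrightarrow> l) (at 0)))"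

definition gateaux_derivative ::
    "('a::real_normed_vector \<Rightarrow> 'b::real_normed_vector) \<Rightarrow> 'a \<Rightarrow> 'a \<Rightarrow> 'b" where
  "gateaux_derivative f x v = Lim (at 0) (\<lambda>t::real. (f (x + t *\<^sub>R v) - f x) /\<^sub>R t)"

lemma gateaux_derivative_tendsto:
  assumes "gateaux_differentiable_at f x" "v \<noteq> 0"
  shows "((\<lambda>t::real. (f (x + t *\<^sub>R v) - f x) /\<^sub>R t) \<longlongrightarrow> gateaux_derivative f x v) (at 0)"
proof -
  obtain l where l: "((\<lambda>t::real. (f (x + t *\<^sub>R v) - f x) /\<^sub>R t) \<longlongrightarrow> l) (at 0)"
    using assms unfolding gateaux_differentiable_at_def by blast
  then have "gateaux_derivative f x v = l"
    unfolding gateaux_derivative_def by (intro tendsto_Lim) simp_all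
  with l show ?thesis by simp
qed

definition partially_gateaux_differentiable_on ::
    "('x::real_normed_vector \<times> 'y::real_normed_vector \<Rightarrow> 'z::real_normed_vector) \<Rightarrow> ('x \<times> 'y) set \<Rightarrow> bool"
  where
  "partially_gateaux_differentiable_on F S \<longleftrightarrow>
     (\<forall>(x, y)\<in>S. gateaux_differentiable_at (\<lambda>u. F (u, y)) x \<and>
                  gateaux_differentiable_at (\<lambda>u. F (x, u)) y)"

definition partially_frechet_differentiable_on ::
    "('x::real_normed_vector \<times> 'y::real_normed_vector \<Rightarrow> 'z::real_normed_vector) \<Rightarrow> ('x \<times> 'y) set \<Rightarrow> bool"
  where
  "partially_frechet_differentiable_on F S \<longleftrightarrow>
     (\<forall>(x, y)\<in>S. (\<lambda>u. F (u, y)) differentiable (at x) \<and>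
                  (\<lambda>u. F (x, u)) differentiable (at y))"

definition partial_gateaux_1 ::
    "('x::real_normed_vector \<times> 'y \<Rightarrow> 'z::real_normed_vector) \<Rightarrow> 'x \<times> 'y \<Rightarrow> 'x \<Rightarrow> 'z"
    (\<open>\<partial>\<^sub>1\<close>) where
  "\<partial>\<^sub>1 F p = gateaux_derivative (\<lambda>u. F (u, snd p)) (fst p)"

definition partial_frechet_1 ::
    "('x::real_normed_vector \<times> 'y \<Rightarrow> 'z::real_normed_vector) \<Rightarrow> 'x \<times> 'y \<Rightarrow> 'x \<Rightarrow> 'z"
    (\<open>\<nabla>\<^sub>1\<close>) where
  "\<nabla>\<^sub>1 F p = frechet_derivative (\<lambda>u. F (u, snd p)) (at (fst p))"

end

theory Submission
  imports Defs
begin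

text \<open>
  For \<open>v \<in> C\<close> and small \<open>t > 0\<close> the point \<open>w + t v\<close> lies in the open set \<open>A\<close> and dominates \<open>w\<close>.
  Monotonicity therefore puts the increment of \<open>F\<close> from \<open>w\<close> to \<open>w + t v\<close> into \<open>M\<close>, and dividing
  by \<open>t > 0\<close> keeps it there because \<open>M\<close> is a cone. As \<open>t\<close> decreases to \<open>0\<close> these quotients tend to
  the directional derivative, which lies in \<open>M\<close> because \<open>M\<close> is closed
  (\<open>directional_limit_in_cone\<close>). The order-decreasing case is the same argument for \<open>-F\<close>. A
  Frechet derivative is evaluated as the limit of the same quotients
  (\<open>has_derivative_imp_directional_limit\<close>), so it is covered as well.
\<close>

text \<open>
  Only the limit from the right enters: for negative \<open>t\<close> the points \<open>x + t v\<close> need not satisfy the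
  increment condition.
\<close>

lemma directional_limit_in_cone:
  fixes f :: "'a::real_normed_vector \<Rightarrow> 'b::real_normed_vector"
  assumes "closed M" "cone M" "open A" "x \<in> A"
    and incr: "\<And>t. t > 0 \<Longrightarrow> x + t *\<^sub>R v \<in> A \<Longrightarrow> f (x + t *\<^sub>R v) - f x \<in> M"
    and lim: "((\<lambda>t. (f (x + t *\<^sub>R v) - f x) /\<^sub>R t) \<longlongrightarrow> l) (at_right 0)"
  shows "l \<in> M"
proof -
  have "((\<lambda>t. x + t *\<^sub>R v) \<longlongrightarrow> x + 0 *\<^sub>R v) (at_right 0)"
    by (intro tendsto_intros)
  then have "\<forall>\<^sub>F t in at_right 0. x + t *\<^sub>R v \<in> A"
    using topological_tendstoD[of _ x _ A] \<open>open A\<close> \<open>x \<in> A\<close> by simp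
  moreover have "\<forall>\<^sub>F t in at_right (0::real). t > 0"
    by (rule eventually_at_right_less)
  ultimately have "\<forall>\<^sub>F t in at_right 0. (f (x + t *\<^sub>R v) - f x) /\<^sub>R t \<in> M"
    by eventually_elim (use incr \<open>cone M\<close> in \<open>simp add: cone_def\<close>)
  then show ?thesis
    using Lim_in_closed_set[OF \<open>closed M\<close> _ _ lim] by simp
qed

lemma has_derivative_imp_directional_limit:
  fixes f :: "'a::real_normed_vector \<Rightarrow> 'b::real_normed_vector"
  assumes "(f has_derivative f') (at x)"
  shows "((\<lambda>t. (f (x + t *\<^sub>R v) - f x) /\<^sub>R t) \<longlongrightarrow> f' v) (at 0)"
proof -
  have "((\<lambda>t. x + t *\<^sub>R v) has_derivative (\<lambda>t. t *\<^sub>R v)) (at 0)"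
    by (auto intro!: derivative_eq_intros)
  then have "((\<lambda>t. f (x + t *\<^sub>R v)) has_derivative (\<lambda>t. f' (t *\<^sub>R v))) (at 0)"
    using has_derivative_compose[of "\<lambda>t. x + t *\<^sub>R v" _ 0 UNIV f f'] assms by simp
  then have "((\<lambda>t. norm ((f (x + t *\<^sub>R v) - f x - f' (t *\<^sub>R v)) /\<^sub>R \<bar>t\<bar>)) \<longlongrightarrow> 0) (at 0)"
    by (intro tendsto_norm_zero) (simp add: has_derivative_at_within)
  then have "((\<lambda>t. norm ((f (x + t *\<^sub>R v) - f x) /\<^sub>R t - f' v)) \<longlongrightarrow> 0) (at 0)"
  proof (rule Lim_transform_eventually)
    have eq: "norm ((f (x + t *\<^sub>R v) - f x - f' (t *\<^sub>R v)) /\<^sub>R \<bar>t\<bar>)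
        = norm ((f (x + t *\<^sub>R v) - f x) /\<^sub>R t - f' v)" if "t \<noteq> 0" for t
    proof -
      have "(f (x + t *\<^sub>R v) - f x) /\<^sub>R t - f' v = (f (x + t *\<^sub>R v) - f x - f' (t *\<^sub>R v)) /\<^sub>R t"
        using that
        by (simp add: linear_cmul[OF has_derivative_linear[OF assms]] scaleR_diff_right)
      then show ?thesis by simp
    qed
    show "\<forall>\<^sub>F t in at 0. norm ((f (x + t *\<^sub>R v) - f x - f' (t *\<^sub>R v)) /\<^sub>R \<bar>t\<bar>)
        = norm ((f (x + t *\<^sub>R v) - f x) /\<^sub>R t - f' v)"
      unfolding eventually_at_filter by (rule always_eventually) (use eq in blast)
  qed
  then show ?thesis
    by (simp add: tendsto_norm_zero_iff LIM_zero_iff)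
qed

text \<open>
  The two monotone cases are stated for an arbitrary limit \<open>l\<close> of difference quotients, so that
  they serve the Gateaux and the Frechet derivative alike.
\<close>

lemma order_increasing_1_limit:
  assumes "ordering_cone C" "ordering_cone M" "open A" "w \<in> A" "v \<in> C"
    and incr: "order_increasing_1 C M A F y"
    and lim: "((\<lambda>t. (F (w + t *\<^sub>R v, y) - F (w, y)) /\<^sub>R t) \<longlongrightarrow> l) (at 0)"
  shows "0 \<preceq>\<^bsub>M\<^esub> l"
proof -
  have "l \<in> M"
  proof (rule directional_limit_in_cone[where f = "\<lambda>u. F (u, y)"])
    show "F (w + t *\<^sub>R v, y) - F (w, y) \<in> M" if "t > 0" "w + t *\<^sub>R v \<in> A" for t
      using assms that
      unfolding order_increasing_1_def cone_le_def ordering_cone_def cone_def by auto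
    show "((\<lambda>t. (F (w + t *\<^sub>R v, y) - F (w, y)) /\<^sub>R t) \<longlongrightarrow> l) (at_right 0)"
      using lim by (simp add: filterlim_at_split)
  qed (use assms in \<open>auto simp: ordering_cone_def\<close>)
  then show ?thesis by (simp add: cone_le_def)
qed

lemma order_decreasing_1_limit:
  assumes "ordering_cone C" "ordering_cone M" "open A" "w \<in> A" "v \<in> C"
    and decr: "order_decreasing_1 C M A F y"
    and lim: "((\<lambda>t. (F (w + t *\<^sub>R v, y) - F (w, y)) /\<^sub>R t) \<longlongrightarrow> l) (at 0)"
  shows "l \<preceq>\<^bsub>M\<^esub> 0"
proof -
  have "order_increasing_1 C M A (\<lambda>p. - F p) y"
    using decr unfolding order_increasing_1_def order_decreasing_1_def cone_le_def by simp
  moreover have "((\<lambda>t. (- F (w + t *\<^sub>R v, y) - - F (w, y)) /\<^sub>R t) \<longlongrightarrow> - l) (at 0)"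
    using tendsto_minus[OF lim] by (simp add: scaleR_diff_right)
  ultimately have "0 \<preceq>\<^bsub>M\<^esub> - l"
    by (rule order_increasing_1_limit[OF assms(1-5)])
  then show ?thesis by (simp add: cone_le_def)
qed

theorem theorem8p2:
  fixes C A :: "'x::banach set"
    and K B :: "'y::banach set"
    and M :: "'z::banach set"
    and F :: "'x \<times> 'y \<Rightarrow> 'z"
    and ybar :: 'y
  assumes "ordering_cone C" and "ordering_cone K" and "ordering_cone M"
    and "A \<noteq> {}" and "convex A" and "open A"
    and "B \<noteq> {}" and "convex B" and "open B"
    and "ybar \<in> B"
  shows
    "(partially_gateaux_differentiable_on F (A \<times> B) \<longrightarrow>
        (order_increasing_1 C M A F ybar \<longrightarrow>
           (\<forall>w\<in>A. \<forall>v\<in>C - {0}. 0 \<preceq>\<^bsub>M\<^esub> \<partial>\<^sub>1 F (w, ybar) v)) \<and>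
        (order_decreasing_1 C M A F ybar \<longrightarrow>
           (\<forall>w\<in>A. \<forall>v\<in>C - {0}. \<partial>\<^sub>1 F (w, ybar) v \<preceq>\<^bsub>M\<^esub> 0))) \<and>
     (partially_frechet_differentiable_on F (A \<times> B) \<longrightarrow>
        (order_increasing_1 C M A F ybar \<longrightarrow>
           (\<forall>w\<in>A. \<forall>v\<in>C - {0}. 0 \<preceq>\<^bsub>M\<^esub> \<nabla>\<^sub>1 F (w, ybar) v)) \<and>
        (order_decreasing_1 C M A F ybar \<longrightarrow>
           (\<forall>w\<in>A. \<forall>v\<in>C - {0}. \<nabla>\<^sub>1 F (w, ybar) v \<preceq>\<^bsub>M\<^esub> 0)))"
proof -
  have gateaux: "((\<lambda>t. (F (w + t *\<^sub>R v, ybar) - F (w, ybar)) /\<^sub>R t) \<longlongrightarrow> \<partial>\<^sub>1 F (w, ybar) v) (at 0)"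
    if "partially_gateaux_differentiable_on F (A \<times> B)" "w \<in> A" "v \<noteq> 0" for w v
  proof -
    have "gateaux_differentiable_at (\<lambda>u. F (u, ybar)) w"
      using that \<open>ybar \<in> B\<close> unfolding partially_gateaux_differentiable_on_def by blast
    from gateaux_derivative_tendsto[OF this \<open>v \<noteq> 0\<close>] show ?thesis
      by (simp add: partial_gateaux_1_def)
  qed
  have frechet: "((\<lambda>t. (F (w + t *\<^sub>R v, ybar) - F (w, ybar)) /\<^sub>R t) \<longlongrightarrow> \<nabla>\<^sub>1 F (w, ybar) v) (at 0)"
    if "partially_frechet_differentiable_on F (A \<times> B)" "w \<in> A" for w v
  proof -
    have "(\<lambda>u. F (u, ybar)) differentiable (at w)"
      using that \<open>ybar \<in> B\<close> unfolding partially_frechet_differentiable_on_def by blast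
    then have "((\<lambda>u. F (u, ybar)) has_derivative \<nabla>\<^sub>1 F (w, ybar)) (at w)"
      by (simp add: partial_frechet_1_def frechet_derivative_works)
    from has_derivative_imp_directional_limit[OF this] show ?thesis .
  qed
  note increasing = order_increasing_1_limit[OF assms(1,3,6)]
    and decreasing = order_decreasing_1_limit[OF assms(1,3,6)]
  show ?thesis
  proof (intro conjI impI ballI)
    fix w v
    assume "w \<in> A" "v \<in> C - {0}"
    then have v: "v \<in> C" "v \<noteq> 0" by auto
    show "0 \<preceq>\<^bsub>M\<^esub> \<partial>\<^sub>1 F (w, ybar) v"
      if "partially_gateaux_differentiable_on F (A \<times> B)" "order_increasing_1 C M A F ybar"
      using increasing[OF \<open>w \<in> A\<close> v(1) that(2) gateaux[OF that(1) \<open>w \<in> A\<close> v(2)]] .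
    show "\<partial>\<^sub>1 F (w, ybar) v \<preceq>\<^bsub>M\<^esub> 0"
      if "partially_gateaux_differentiable_on F (A \<times> B)" "order_decreasing_1 C M A F ybar"
      using decreasing[OF \<open>w \<in> A\<close> v(1) that(2) gateaux[OF that(1) \<open>w \<in> A\<close> v(2)]] .
    show "0 \<preceq>\<^bsub>M\<^esub> \<nabla>\<^sub>1 F (w, ybar) v"
      if "partially_frechet_differentiable_on F (A \<times> B)" "order_increasing_1 C M A F ybar"
      using increasing[OF \<open>w \<in> A\<close> v(1) that(2) frechet[OF that(1) \<open>w \<in> A\<close>]] .
    show "\<nabla>\<^sub>1 F (w, ybar) v \<preceq>\<^bsub>M\<^esub> 0"
      if "partially_frechet_differentiable_on F (A \<times> B)" "order_decreasing_1 C M A F ybar"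
      using decreasing[OF \<open>w \<in> A\<close> v(1) that(2) frechet[OF that(1) \<open>w \<in> A\<close>]] .
  qed
qed

end
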